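(* Let $n\ge 2$ and $d\ge 0$ be integers. If $n>d$, then $$F^{(n-1,1)}_d=\sum_{i=0}^{d-1}P(i).$$
   Context: $P(i)$ is the number of integer partitions of $i$ (with $P(0)=1$). For $\lambda,\mu\vdash n$, the Kostka number $K_{\lambda,\mu}$ is the number of semistandard Young tableaux of shape $\lambda$ and content $\mu$. A partition of $d$ with $n$ parts, written $\mathbf a\vdash d$, $\#\mathbf a=n$, is a tuple $\mathbf a=(a_1\ge\dots\ge a_n\ge0)$ with sum $d$, zeros allowed as padding. If $\mathbf a=(a_1^{m_1},\dots,a_\ell^{m_\ell})$ with distinct values $a_1,\dots,a_\ell$ (possibly including $0$) and multiplicities $m_j\ge 1$, its metatype $m(\mathbf a)$ is the partition of $n$ obtained by reordering $(m_1,\dots,m_\ell)$ to be nonincreasing. For $\lambda\vdash n$, $$F^\lambda_d:=\sum_{\mathbf a\vdash d,\ \#\mathbf a=n}K_{\lambda,m(\mathbf a)}.$$ *)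

theory Defs
  imports Main
begin

definition partitions :: "nat \<Rightarrow> nat list set" where
  "partitions i = {a. sorted_wrt (\<ge>) a \<and> 0 \<notin> set a \<and> sum_list a = i}"

definition num_partitions :: "nat \<Rightarrow> nat" where
  "num_partitions i = card (partitions i)"

definition padded_partitions :: "nat \<Rightarrow> nat \<Rightarrow> nat list set" where
  "padded_partitions n d = {a. length a = n \<and> sorted_wrt (\<ge>) a \<and> sum_list a = d}"

text \<open>The value \<open>0\<close>, if it occurs, contributes its multiplicity like any other value.\<close>

definition metatype :: "nat list \<Rightarrow> nat list" where
  "metatype a = rev (sort (map (count_list a) (remdups a)))"

text \<open>
  A tableau is the list of its rows from top to bottom (English convention), so
  \<open>T ! i ! j\<close> is the entry in row \<open>i\<close> and column \<open>j\<close>, both indexed from \<open>0\<close>.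
\<close>

definition semistandard :: "nat list \<Rightarrow> nat list list \<Rightarrow> bool" where
  "semistandard \<nu> T \<longleftrightarrow>
     map length T = \<nu> \<and>
     (\<forall>row \<in> set T. sorted_wrt (\<le>) row) \<and>
     (\<forall>i j. Suc i < length T \<and> j < length (T ! i) \<and> j < length (T ! Suc i)
        \<longrightarrow> T ! i ! j < T ! Suc i ! j)"

text \<open>
  The entries of a tableau of content \<open>\<mu>\<close> are \<open>1, \<dots>, length \<mu>\<close>, the entry \<open>k\<close> occurring
  as often as the \<open>k\<close>-th part of \<open>\<mu>\<close> says, which is \<open>\<mu> ! (k - 1)\<close>.
\<close>

definition has_content :: "nat list list \<Rightarrow> nat list \<Rightarrow> bool" where
  "has_content T \<mu> \<longleftrightarrow>
     set (concat T) \<subseteq> {1..length \<mu>} \<and>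
     (\<forall>k \<in> {1..length \<mu>}. count_list (concat T) k = \<mu> ! (k - 1))"

definition kostka :: "nat list \<Rightarrow> nat list \<Rightarrow> nat" where
  "kostka \<nu> \<mu> = card {T. semistandard \<nu> T \<and> has_content T \<mu>}"

text \<open>The \<open>n\<close> with \<open>\<nu> \<turnstile> n\<close> is recovered as \<open>sum_list \<nu>\<close>.\<close>

definition F :: "nat list \<Rightarrow> nat \<Rightarrow> nat" where
  "F \<nu> d = (\<Sum>a \<in> padded_partitions (sum_list \<nu>) d. kostka \<nu> (metatype a))"

lemma finite_partitions: "finite (partitions i)"
proof (rule finite_subset)
  have "length a \<le> sum_list a" if "0 \<notin> set a" for a :: "nat list"
    using that by (induction a) auto
  then show "partitions i \<subseteq> {a. set a \<subseteq> {..i} \<and> length a \<le> i}"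
    by (auto simp: partitions_def intro: member_le_sum_list)
qed (simp add: finite_lists_length_le)

lemma finite_padded_partitions: "finite (padded_partitions n d)"
proof (rule finite_subset)
  show "padded_partitions n d \<subseteq> {a. set a \<subseteq> {..d} \<and> length a = n}"
    by (auto simp: padded_partitions_def intro: member_le_sum_list)
qed (simp add: finite_lists_length_eq)

lemma finite_tableaux: "finite {T. semistandard \<nu> T \<and> has_content T \<mu>}"
proof (rule finite_subset)
  let ?R = "{r. set r \<subseteq> {1..length \<mu>} \<and> length r \<le> sum_list \<nu>}"
  have "length r \<le> sum_list (map length T)" if "r \<in> set T" for r and T :: "nat list list"
    using that by (intro member_le_sum_list) auto
  then show "{T. semistandard \<nu> T \<and> has_content T \<mu>} \<subseteq> {T. set T \<subseteq> ?R \<and> length T = length \<nu>}"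
    by (fastforce simp: semistandard_def has_content_def)
  show "finite {T. set T \<subseteq> ?R \<and> length T = length \<nu>}"
    by (intro finite_lists_length_eq finite_lists_length_le) simp
qed

end

theory Submission
  imports Defs "HOL-Library.Multiset"
begin

text \<open>
  A semistandard tableau of shape \<open>(n - 1, 1)\<close> and content \<open>\<mu>\<close> is determined by the entry \<open>k\<close> of
  its second row, since the first row must list the remaining entries in increasing order. When
  all parts of \<open>\<mu>\<close> are positive, every \<open>k \<noteq> 1\<close> is possible: the corner entry is then \<open>1 < k\<close>.
  Hence the Kostka number is the number of parts of \<open>\<mu>\<close> minus one (\<open>kostka_near_row\<close>). For
  \<open>\<mu> = m(a)\<close> this is the number of distinct values of \<open>a\<close> minus one.

  If \<open>d < n\<close>, a partition of \<open>d\<close> padded to \<open>n\<close> parts contains the value \<open>0\<close>, so the number in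
  question counts the distinct positive values, that is, the distinct parts of the unpadded
  partition. The theorem thus says that the partitions of \<open>d\<close> have altogether
  \<open>P(0) + \<dots> + P(d - 1)\<close> distinct parts (\<open>sum_card_parts\<close>). Counting pairs of a partition and
  one of its distinct parts \<open>k\<close> by \<open>k\<close> instead, removing one copy of \<open>k\<close> leaves an arbitrary
  partition of \<open>d - k\<close>, and \<open>k\<close> ranges over \<open>1, \<dots>, d\<close>.
\<close>

section \<open>Kostka numbers of shape \<open>(n - 1, 1)\<close>\<close>

definition content_mset :: "nat list \<Rightarrow> nat multiset" where
  "content_mset \<mu> = (\<Sum>k\<in>{1..length \<mu>}. replicate_mset (\<mu> ! (k - 1)) k)"

lemma count_content_mset:
  "count (content_mset \<mu>) k = (if k \<in> {1..length \<mu>} then \<mu> ! (k - 1) else 0)"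
proof -
  have "count (content_mset \<mu>) k = (\<Sum>j\<in>{1..length \<mu>}. if j = k then \<mu> ! (j - 1) else 0)"
    unfolding content_mset_def count_sum by (rule sum.cong) auto
  then show ?thesis by simp
qed

lemma size_content_mset: "size (content_mset \<mu>) = sum_list \<mu>"
proof -
  have "size (content_mset \<mu>) = (\<Sum>k\<in>{1..length \<mu>}. \<mu> ! (k - 1))"
    by (simp add: content_mset_def size_multiset_sum)
  also have "\<dots> = (\<Sum>k<length \<mu>. \<mu> ! k)"
    by (rule sum.reindex_bij_witness[of _ Suc "\<lambda>k. k - 1"]) auto
  finally show ?thesis by (simp add: sum_list_sum_nth atLeast0LessThan)
qed

lemma has_content_iff_mset: "has_content T \<mu> \<longleftrightarrow> mset (concat T) = content_mset \<mu>"
proof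
  assume T: "has_content T \<mu>"
  show "mset (concat T) = content_mset \<mu>"
  proof (rule multiset_eqI)
    fix k
    show "count (mset (concat T)) k = count (content_mset \<mu>) k"
    proof (cases "k \<in> {1..length \<mu>}")
      case True
      then show ?thesis using T by (auto simp: has_content_def count_content_mset count_mset)
    next
      case False
      then have "k \<notin> set (concat T)" using T unfolding has_content_def by blast
      then have "count_list (concat T) k = 0" by (simp only: count_list_0_iff not_False_eq_True)
      then show ?thesis using False by (auto simp: count_content_mset count_mset)
    qed
  qed
next
  assume T: "mset (concat T) = content_mset \<mu>"
  have count: "count_list (concat T) k = (if k \<in> {1..length \<mu>} then \<mu> ! (k - 1) else 0)" for k
    using count_content_mset[of \<mu> k] by (simp only: count_mset flip: T)
  have "k \<in> {1..length \<mu>}" if "k \<in> set (concat T)" for k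
    using that count[of k] count_list_0_iff[of "concat T" k] by (metis (full_types))
  then show "has_content T \<mu>"
    unfolding has_content_def using count by (metis subsetI)
qed

lemma semistandard_near_row_iff:
  assumes "n \<ge> 2"
  shows "semistandard [n - 1, 1] T \<longleftrightarrow>
    (\<exists>r k. T = [r, [k]] \<and> length r = n - 1 \<and> sorted r \<and> r ! 0 < k)"
proof
  assume T: "semistandard [n - 1, 1] T"
  then have "map length T = [n - 1, 1]" by (simp add: semistandard_def)
  then obtain r s where rs: "T = [r, s]" "length r = n - 1" "length s = 1"
    by (auto simp: map_eq_Cons_conv)
  then obtain k where "s = [k]" by (auto simp: length_Suc_conv)
  moreover have "T ! 0 ! 0 < T ! Suc 0 ! 0"
    using T rs assms unfolding semistandard_def by (metis One_nat_def diff_is_0_eq gr0I length_Cons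
      lessI list.size(3) not_less_eq_eq nth_Cons_0 nth_Cons_Suc numeral_2_eq_2)
  ultimately show "\<exists>r k. T = [r, [k]] \<and> length r = n - 1 \<and> sorted r \<and> r ! 0 < k"
    using T rs by (auto simp: semistandard_def)
next
  assume "\<exists>r k. T = [r, [k]] \<and> length r = n - 1 \<and> sorted r \<and> r ! 0 < k"
  then show "semistandard [n - 1, 1] T"
    by (auto simp: semistandard_def less_Suc_eq)
qed

text \<open>
  Semistandardness forces the second-row entry to exceed the corner entry, which is at least \<open>1\<close>;
  conversely, if \<open>k > 1\<close> then a \<open>1\<close> remains for the first row, because the first part of \<open>\<mu>\<close> is
  positive, and sorting puts it into the corner. So the tableaux correspond to \<open>k = 2, \<dots>, length \<mu>\<close>.
\<close>

lemma kostka_near_row: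
  assumes n: "n \<ge> 2" and pos: "0 \<notin> set \<mu>" and sum: "sum_list \<mu> = n"
  shows "kostka [n - 1, 1] \<mu> = length \<mu> - 1"
proof -
  define M where "M = content_mset \<mu>"
  define tab where "tab k = [sorted_list_of_multiset (M - {#k#}), [k]]" for k
  have mem: "k \<in># M \<longleftrightarrow> k \<in> {1..length \<mu>}" for k
  proof -
    have "\<mu> ! (k - 1) \<noteq> 0" if "k \<in> {1..length \<mu>}"
      using that pos by (metis One_nat_def Suc_le_lessD Suc_pred atLeastAtMost_iff nth_mem)
    then show ?thesis
      by (simp add: M_def count_content_mset flip: count_greater_zero_iff)
  qed
  have size_M: "size M = n"
    by (simp add: M_def size_content_mset sum)
  have "{T. semistandard [n - 1, 1] T \<and> has_content T \<mu>} = tab ` {2..length \<mu>}"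
  proof (intro equalityI subsetI)
    fix T assume "T \<in> {T. semistandard [n - 1, 1] T \<and> has_content T \<mu>}"
    then obtain r k where T: "T = [r, [k]]" "length r = n - 1" "sorted r" "r ! 0 < k"
      and content: "mset (concat T) = M"
      unfolding semistandard_near_row_iff[OF n] has_content_iff_mset M_def by blast
    have M: "M = add_mset k (mset r)" using content T(1) by auto
    have "r ! 0 \<in># M" using M T(2) n by auto
    then have "k \<in> {2..length \<mu>}"
      using mem[of k] mem[of "r ! 0"] M T(4) by auto
    moreover have "r = sorted_list_of_multiset (M - {#k#})"
      using M T(3) by (simp add: sorted_sort_id)
    ultimately show "T \<in> tab ` {2..length \<mu>}"
      using T(1) by (auto simp: tab_def)
  next
    fix T assume "T \<in> tab ` {2..length \<mu>}"
    then obtain k where k: "k \<in> {2..length \<mu>}" "T = tab k" by blast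
    define r where "r = sorted_list_of_multiset (M - {#k#})"
    have kM: "k \<in># M" using k(1) mem[of k] by auto
    have len: "length r = n - 1"
      using kM by (simp add: r_def size_Diff_singleton size_M flip: size_mset)
    have srt: "sorted r" by (simp add: r_def)
    have "1 \<in># M - {#k#}"
      using k(1) mem[of 1] by (auto simp: in_diff_count not_in_iff)
    then have "1 \<in> set r" by (simp add: r_def)
    then obtain i where "i < length r" "r ! i = 1" by (auto simp: in_set_conv_nth)
    then have "r ! 0 \<le> 1" using sorted_nth_mono[OF srt, of 0 i] by simp
    then have "r ! 0 < k" using k(1) by simp
    moreover have "T = [r, [k]]" by (simp add: k(2) tab_def r_def)
    moreover have "mset (concat [r, [k]]) = M" using kM by (simp add: r_def)
    ultimately show "T \<in> {T. semistandard [n - 1, 1] T \<and> has_content T \<mu>}"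
      using len srt unfolding semistandard_near_row_iff[OF n] has_content_iff_mset M_def by blast
  qed
  moreover have "inj_on tab {2..length \<mu>}"
    by (rule inj_onI) (simp add: tab_def)
  ultimately show ?thesis
    by (simp add: kostka_def card_image)
qed

section \<open>Metatypes\<close>

lemma length_metatype: "length (metatype a) = card (set a)"
  by (simp add: metatype_def length_remdups_card_conv)

lemma zero_notin_metatype: "0 \<notin> set (metatype a)"
  by (auto simp: metatype_def count_list_0_iff)

lemma sum_list_metatype: "sum_list (metatype a) = length a"
proof -
  have "sum_list (metatype a) = sum_list (map (count_list a) (remdups a))"
    unfolding metatype_def by (metis mset_rev mset_sort sum_mset_sum_list)
  also have "\<dots> = (\<Sum>x\<in>set a. count_list a x)"
    by (simp add: sum_list_distinct_conv_sum_set)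
  also have "\<dots> = length a"
    by (rule sum_count_set) auto
  finally show ?thesis .
qed

section \<open>Counting distinct parts\<close>

lemma sorted_desc_unique:
  fixes a b :: "'a::linorder list"
  assumes "sorted_wrt (\<ge>) a" "sorted_wrt (\<ge>) b" "mset a = mset b"
  shows "a = b"
proof -
  have "sorted (rev a)" "sorted (rev b)"
    using assms(1,2) by (simp_all add: sorted_wrt_rev)
  then have "rev a = rev b"
    using assms(3) by (metis mset_rev properties_for_sort)
  then show ?thesis by simp
qed

lemma sorted_desc_remove1: "sorted_wrt (\<ge>) a \<Longrightarrow> sorted_wrt (\<ge>) (remove1 k a)"
  by (induction a) (auto dest: in_set_remove1[THEN iffD1, rotated] notin_set_remove1)

text \<open>
  A weakly decreasing list is determined by its multiset of entries, so removing one copy of \<open>k\<close>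
  is undone by putting it back and sorting again; any partition of \<open>d - k\<close> may be the remainder.
\<close>

lemma card_partitions_with_part:
  assumes "k \<in> {1..d}"
  shows "card {b \<in> partitions d. k \<in> set b} = num_partitions (d - k)"
proof -
  have "bij_betw (remove1 k) {b \<in> partitions d. k \<in> set b} (partitions (d - k))"
    unfolding bij_betw_def
  proof (intro conjI inj_onI equalityI subsetI)
    fix a b assume "a \<in> {b \<in> partitions d. k \<in> set b}" "b \<in> {b \<in> partitions d. k \<in> set b}"
      and eq: "remove1 k a = remove1 k b"
    then have ab: "sorted_wrt (\<ge>) a" "sorted_wrt (\<ge>) b" "k \<in># mset a" "k \<in># mset b"
      by (auto simp: partitions_def)
    have "mset a - {#k#} = mset b - {#k#}" using eq by (metis mset_remove1)
    then have "mset a = mset b" using ab(3,4) by (metis insert_DiffM)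
    then show "a = b" using ab(1,2) by (blast intro: sorted_desc_unique)
  next
    fix c assume "c \<in> remove1 k ` {b \<in> partitions d. k \<in> set b}"
    then obtain b where b: "b \<in> partitions d" "k \<in> set b" "c = remove1 k b" by blast
    have "sum_list c = d - k"
      using b sum_list_map_remove1[of k b id] by (simp add: partitions_def)
    moreover have "0 \<notin> set c"
      using b set_remove1_subset[of k b] by (auto simp: partitions_def)
    moreover have "sorted_wrt (\<ge>) c"
      using b by (simp add: partitions_def sorted_desc_remove1)
    ultimately show "c \<in> partitions (d - k)" by (simp add: partitions_def)
  next
    fix c assume c: "c \<in> partitions (d - k)"
    define b where "b = rev (sort (k # c))"
    have srt: "sorted_wrt (\<ge>) b" unfolding b_def by (simp add: sorted_wrt_rev del: sort_key_simps)
    have mset_b: "mset b = add_mset k (mset c)" by (simp add: b_def)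
    have "sum_list b = d"
      using mset_b c assms by (simp add: partitions_def flip: sum_mset_sum_list)
    moreover have set_b: "set b = insert k (set c)"
      using mset_b by (metis set_mset_add_mset_insert set_mset_mset)
    ultimately have "b \<in> {b \<in> partitions d. k \<in> set b}"
      using c assms srt by (auto simp: partitions_def)
    moreover have "remove1 k b = c"
      using srt mset_b c by (intro sorted_desc_unique sorted_desc_remove1) (auto simp: partitions_def)
    ultimately show "c \<in> remove1 k ` {b \<in> partitions d. k \<in> set b}" by blast
  qed
  then show ?thesis
    unfolding num_partitions_def by (rule bij_betw_same_card)
qed

lemma sum_card_parts: "(\<Sum>b\<in>partitions d. card (set b)) = (\<Sum>i<d. num_partitions i)"
proof -
  have parts: "set b \<subseteq> {1..d}" if "b \<in> partitions d" for b
  proof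
    fix x assume "x \<in> set b"
    then show "x \<in> {1..d}"
      using that member_le_sum_list[of x b] by (auto simp: partitions_def Suc_le_eq intro: gr0I)
  qed
  have "(\<Sum>b\<in>partitions d. card (set b)) = (\<Sum>b\<in>partitions d. \<Sum>k | k \<in> {1..d} \<and> k \<in> set b. 1)"
  proof (rule sum.cong[OF refl])
    fix b assume "b \<in> partitions d"
    then have "{k. k \<in> {1..d} \<and> k \<in> set b} = set b" using parts by blast
    then show "card (set b) = (\<Sum>k | k \<in> {1..d} \<and> k \<in> set b. 1)" by simp
  qed
  also have "\<dots> = (\<Sum>k\<in>{1..d}. \<Sum>b | b \<in> partitions d \<and> k \<in> set b. 1)"
    by (rule sum.swap_restrict) (simp_all add: finite_partitions)
  also have "\<dots> = (\<Sum>k\<in>{1..d}. num_partitions (d - k))"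
    using card_partitions_with_part by simp
  also have "\<dots> = (\<Sum>i<d. num_partitions i)"
    by (rule sum.reindex_bij_witness[of _ "\<lambda>i. d - i" "\<lambda>k. d - k"]) auto
  finally show ?thesis .
qed

section \<open>Removing the padding\<close>

lemma length_le_sum_list: "0 \<notin> set b \<Longrightarrow> length b \<le> sum_list b" for b :: "nat list"
  by (induction b) auto

lemma sorted_desc_split_zeros:
  fixes a :: "nat list"
  assumes "sorted_wrt (\<ge>) a"
  shows "a = filter (\<lambda>x. x \<noteq> 0) a @ replicate (length a - length (filter (\<lambda>x. x \<noteq> 0) a)) 0"
  using assms
proof (induction a)
  case (Cons x a)
  show ?case
  proof (cases "x = 0")
    case True
    with Cons.prems have "\<forall>y\<in>set (x # a). y = 0" by auto
    then have "filter (\<lambda>x. x \<noteq> 0) (x # a) = []" "x # a = replicate (length (x # a)) 0"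
      by (auto simp: filter_empty_conv intro: replicate_eqI)
    then show ?thesis by simp
  qed (use Cons in simp)
qed simp

text \<open>
  A partition of \<open>d\<close> has at most \<open>d\<close> positive parts, so for \<open>d \<le> n\<close> each one can be padded to
  \<open>n\<close> parts, and the zeros can only go at the end.
\<close>

lemma bij_betw_unpad:
  assumes "d \<le> n"
  shows "bij_betw (filter (\<lambda>x. x \<noteq> 0)) (padded_partitions n d) (partitions d)"
proof (rule bij_betw_byWitness[where f' = "\<lambda>b. b @ replicate (n - length b) 0"])
  show "\<forall>a\<in>padded_partitions n d.
      filter (\<lambda>x. x \<noteq> 0) a @ replicate (n - length (filter (\<lambda>x. x \<noteq> 0) a)) 0 = a"
    using sorted_desc_split_zeros by (auto simp: padded_partitions_def)
  show "\<forall>b\<in>partitions d. filter (\<lambda>x. x \<noteq> 0) (b @ replicate (n - length b) 0) = b"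
    by (auto simp: partitions_def filter_id_conv intro!: gr0I)
  have "sum_list (filter (\<lambda>x. x \<noteq> 0) a) = sum_list a" for a :: "nat list"
    by (induction a) auto
  then show "filter (\<lambda>x. x \<noteq> 0) ` padded_partitions n d \<subseteq> partitions d"
    by (auto simp: padded_partitions_def partitions_def intro: sorted_wrt_filter)
  have "sorted_wrt (\<ge>) (replicate m (0::nat))" for m
    by (induction m) auto
  then show "(\<lambda>b. b @ replicate (n - length b) 0) ` partitions d \<subseteq> padded_partitions n d"
    using assms length_le_sum_list
    by (fastforce simp: padded_partitions_def partitions_def sorted_wrt_append sum_list_replicate)
qed

theorem proposition3p5:
  fixes n d :: nat
  assumes "n \<ge> 2" and "n > d"
  shows "F [n - 1, 1] d = (\<Sum>i<d. num_partitions i)"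
proof -
  have kostka: "kostka [n - 1, 1] (metatype a) = card (set (filter (\<lambda>x. x \<noteq> 0) a))"
    if a: "a \<in> padded_partitions n d" for a
  proof -
    have "0 \<in> set a"
      using a assms(2) length_le_sum_list[of a] by (force simp: padded_partitions_def)
    moreover have "set (filter (\<lambda>x. x \<noteq> 0) a) = set a - {0}" by auto
    moreover have "kostka [n - 1, 1] (metatype a) = card (set a) - 1"
      using a assms(1) kostka_near_row[of n "metatype a"]
      by (simp add: zero_notin_metatype sum_list_metatype length_metatype padded_partitions_def)
    ultimately show ?thesis by (simp add: card_Diff_singleton)
  qed
  have "F [n - 1, 1] d = (\<Sum>a\<in>padded_partitions n d. kostka [n - 1, 1] (metatype a))"
    using assms(1) by (simp add: F_def)
  also have "\<dots> = (\<Sum>a\<in>padded_partitions n d. card (set (filter (\<lambda>x. x \<noteq> 0) a)))"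
    by (rule sum.cong[OF refl kostka])
  also have "\<dots> = (\<Sum>b\<in>partitions d. card (set b))"
    using assms(2) by (intro sum.reindex_bij_betw bij_betw_unpad) simp
  also have "\<dots> = (\<Sum>i<d. num_partitions i)" by (rule sum_card_parts)
  finally show ?thesis .
qed

end
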